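(* Let the capacity $c\in\mathbb{N}\cup\{\infty\}$ of the server be arbitrary but fixed and let $2<\Theta<3$. For every sufficiently small $\varepsilon>0$, there is a set of requests $\sigma$ (an instance of open, non-preemptive online Dial-a-Ride on the line) such that $\textsc{Smartstart}_\Theta$ waits before starting its final schedule and such that $$\frac{\textsc{Smartstart}(\sigma)}{\textsc{Opt}(\sigma)}\ge\frac{2\Theta^2+2\Theta}{\Theta^2+\Theta-2}-\varepsilon .$$
   Context: Open, non-preemptive Dial-a-Ride on the real line. An instance is a finite nonempty set of requests $\sigma=\{\sigma_1,\dots,\sigma_n\}$ with $\sigma_i=(a_i,b_i;r_i)$, $a_i,b_i\in\mathbb{R}$, $r_i\ge 0$: request $\sigma_i$ appears at time $r_i$ at position $a_i$ and must be transported to position $b_i$. A single server of capacity $c\in\mathbb{N}\cup\{\infty\}$ starts at the origin at time $0$, moves with unit speed (it may also wait), cannot pick up a request before its release time, never carries more than $c$ requests at once, and a request that was picked up stays on board until it is delivered at its destination (non-preemptive). In the open version the server need not return to the origin. The length of a schedule is the time from its start until its last request is delivered (waiting included). $L(t,p,R)$ is the length of a shortest schedule that starts at position $p$ at time $t$ and serves all requests in $R\subseteq\sigma$ respecting release times. The offline optimum is $\textsc{Opt}(\sigma):=L(0,0,\sigma)$. In the online problem, $\sigma_i$ is revealed only at time $r_i$, and the number of requests is not known in advance. Algorithm $\textsc{Smartstart}_\Theta$ (parameter $\Theta>1$): let $R_t$ be the set of requests with release time at most $t$ that have not been served by time $t$. Starting at position $p_1=0$ at time $0$, for $j=1,2,\dots$: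 whenever the server is idle at position $p_j$ at current time $t$, it waits until there are unserved released requests and then until the earliest time $t_j:=\min\{t'\ge t: R_{t'}\ne\emptyset,\ t'\ge L(t',p_j,R_{t'})/(\Theta-1)\}$. At time $t_j$ it starts a shortest schedule $S_j$ serving $\sigma_{S_j}:=R_{t_j}$ from $p_j$, and executes it while ignoring all newly appearing requests; it ends at position $p_{j+1}$, the position where the last request of $S_j$ is delivered. $N$ denotes the number of schedules needed to serve $\sigma$, and $\textsc{Smartstart}(\sigma)=t_N+L(t_N,p_N,\sigma_{S_N})$ is the time at which all requests have been served. $\textsc{Smartstart}$ waits before starting the final schedule $S_N$ if $t_N$ is strictly larger than the finishing time $t_{N-1}+L(t_{N-1},p_{N-1},\sigma_{S_{N-1}})$ of $S_{N-1}$ (which is read as time $0$ if $N=1$). *)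

theory Defs
  imports "HOL-Analysis.Analysis" "HOL-Library.Extended_Nat"
begin

section \<open>Open, non-preemptive Dial-a-Ride on the real line\<close>

datatype request = Request (source: real) (target: real) (release: real)

definition dar_instance :: "request set \<Rightarrow> bool" where
  "dar_instance \<sigma> \<longleftrightarrow> finite \<sigma> \<and> \<sigma> \<noteq> {} \<and> (\<forall>q\<in>\<sigma>. 0 \<le> release q)"

datatype action = Pickup request | Deliver request

text \<open>
  \<open>serves c B W as\<close>: starting with the requests \<open>B\<close> on board and the requests \<open>W\<close> still to be
  picked up, the sequence \<open>as\<close> picks up every request of \<open>W\<close> exactly once, delivers every
  request of \<open>B \<union> W\<close> exactly once, and never has more than \<open>c\<close> requests on board.
  The capacity is checked along the sequence of actions and not per point in time: at one and the
  same time a full server may deliver a request and then pick up another one, but it cannot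
  first pick up another one, not even one whose source and target coincide.
\<close>

fun serves :: "enat \<Rightarrow> request set \<Rightarrow> request set \<Rightarrow> action list \<Rightarrow> bool" where
  "serves c B W [] \<longleftrightarrow> B = {} \<and> W = {}"
| "serves c B W (Pickup q # as) \<longleftrightarrow>
     q \<in> W \<and> enat (card (insert q B)) \<le> c \<and> serves c (insert q B) (W - {q}) as"
| "serves c B W (Deliver q # as) \<longleftrightarrow> q \<in> B \<and> serves c (B - {q}) W as"

text \<open>\<open>route s\<close> is the position of the server at (absolute) time \<open>s\<close>;
  the events are listed with their (absolute) times.\<close>

record schedule =
  route :: "real \<Rightarrow> real"
  events :: "(real \<times> action) list"

definition end_time :: "real \<Rightarrow> schedule \<Rightarrow> real" where
  "end_time t S = last (t # map fst (events S))"

definition end_pos :: "real \<Rightarrow> schedule \<Rightarrow> real" where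
  "end_pos t S = route S (end_time t S)"

definition sched_length :: "real \<Rightarrow> schedule \<Rightarrow> real" where
  "sched_length t S = end_time t S - t"

fun event_ok :: "(real \<Rightarrow> real) \<Rightarrow> real \<times> action \<Rightarrow> bool" where
  "event_ok x (s, Pickup q) \<longleftrightarrow> release q \<le> s \<and> x s = source q"
| "event_ok x (s, Deliver q) \<longleftrightarrow> x s = target q"

text \<open>Moving with unit speed or waiting is expressed by the route being 1-Lipschitz. Slower
  motion is thereby admitted too; it reaches the same events at the same times as unit-speed
  motion followed by waiting.\<close>

definition is_schedule :: "enat \<Rightarrow> real \<Rightarrow> real \<Rightarrow> request set \<Rightarrow> schedule \<Rightarrow> bool" where
  "is_schedule c t p R S \<longleftrightarrow>
     route S t = p \<and> 1-lipschitz_on {t..} (route S) \<and>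
     sorted (t # map fst (events S)) \<and>
     serves c {} R (map snd (events S)) \<and>
     (\<forall>e\<in>set (events S). event_ok (route S) e)"

definition shortest_schedule :: "enat \<Rightarrow> real \<Rightarrow> real \<Rightarrow> request set \<Rightarrow> schedule \<Rightarrow> bool" where
  "shortest_schedule c t p R S \<longleftrightarrow>
     is_schedule c t p R S \<and>
     (\<forall>S'. is_schedule c t p R S' \<longrightarrow> sched_length t S \<le> sched_length t S')"

text \<open>For finite \<open>R\<close> and \<open>c \<ge> 1\<close> the infimum is attained, i.e. it is the length of a
  shortest schedule.\<close>

definition L :: "enat \<Rightarrow> real \<Rightarrow> real \<Rightarrow> request set \<Rightarrow> real" where
  "L c t p R = Inf {sched_length t S | S. is_schedule c t p R S}"

definition Opt :: "enat \<Rightarrow> request set \<Rightarrow> real" where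
  "Opt c \<sigma> = L c 0 0 \<sigma>"


section \<open>The algorithm Smartstart\<close>

text \<open>
  A run records the number \<open>N\<close> of schedules and, for \<open>j = 1, \<dots>, N\<close>, the starting time
  \<open>t\<^sub>j\<close>, the starting position \<open>p\<^sub>j\<close>, the set \<open>\<sigma>\<^bsub>S\<^sub>j\<^esub>\<close> of requests served, and the schedule
  \<open>S\<^sub>j\<close>. The values at other indices are irrelevant, except that \<open>start_pos\<close> at \<open>N + 1\<close>
  is the final position.
\<close>

record run =
  num_scheds :: nat
  start_time :: "nat \<Rightarrow> real"
  start_pos :: "nat \<Rightarrow> real"
  served :: "nat \<Rightarrow> request set"
  sched :: "nat \<Rightarrow> schedule"

definition finish :: "enat \<Rightarrow> run \<Rightarrow> nat \<Rightarrow> real" where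
  "finish c \<rho> j =
     (if j = 0 then 0
      else start_time \<rho> j + L c (start_time \<rho> j) (start_pos \<rho> j) (served \<rho> j))"

text \<open>The set \<open>R\<^sub>t\<close> while the server is idle after its first \<open>j - 1\<close> schedules.\<close>

definition pending :: "request set \<Rightarrow> run \<Rightarrow> nat \<Rightarrow> real \<Rightarrow> request set" where
  "pending \<sigma> \<rho> j t = {q\<in>\<sigma>. release q \<le> t} - (\<Union>i\<in>{1..<j}. served \<rho> i)"

definition may_start :: "enat \<Rightarrow> real \<Rightarrow> request set \<Rightarrow> run \<Rightarrow> nat \<Rightarrow> real \<Rightarrow> bool" where
  "may_start c \<Theta> \<sigma> \<rho> j t \<longleftrightarrow>
     finish c \<rho> (j - 1) \<le> t \<and> pending \<sigma> \<rho> j t \<noteq> {} \<and>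
     t \<ge> L c t (start_pos \<rho> j) (pending \<sigma> \<rho> j t) / (\<Theta> - 1)"

text \<open>Shortest schedules need not be unique, so an instance may have several runs, one for
  each way of breaking ties.\<close>

definition smartstart_run :: "enat \<Rightarrow> real \<Rightarrow> request set \<Rightarrow> run \<Rightarrow> bool" where
  "smartstart_run c \<Theta> \<sigma> \<rho> \<longleftrightarrow>
     start_pos \<rho> 1 = 0 \<and>
     (\<forall>j\<in>{1..num_scheds \<rho>}.
        may_start c \<Theta> \<sigma> \<rho> j (start_time \<rho> j) \<and>
        (\<forall>t. may_start c \<Theta> \<sigma> \<rho> j t \<longrightarrow> start_time \<rho> j \<le> t) \<and>
        served \<rho> j = pending \<sigma> \<rho> j (start_time \<rho> j) \<and>
        shortest_schedule c (start_time \<rho> j) (start_pos \<rho> j) (served \<rho> j) (sched \<rho> j) \<and>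
        start_pos \<rho> (Suc j) = end_pos (start_time \<rho> j) (sched \<rho> j)) \<and>
     (\<Union>j\<in>{1..num_scheds \<rho>}. served \<rho> j) = \<sigma>"

definition smartstart_cost :: "enat \<Rightarrow> run \<Rightarrow> real" where
  "smartstart_cost c \<rho> = finish c \<rho> (num_scheds \<rho>)"

definition waits_before_final :: "enat \<Rightarrow> run \<Rightarrow> bool" where
  "waits_before_final c \<rho> \<longleftrightarrow>
     start_time \<rho> (num_scheds \<rho>) > finish c \<rho> (num_scheds \<rho> - 1)"

end

theory Submission imports Defs begin

text \<open>
  In the time that the offline optimum needs to go left to \<open>-s\<close>, Smartstart is lured to the right.
  It starts a schedule of length \<open>(\<Theta> - 1) t\<close> at time \<open>t\<close> without waiting, so a single request
  released at each of the times \<open>1, \<Theta>, \<Theta>\<^sup>2, \<dots>, \<Theta>\<^sup>m\<close> keeps it moving right from time \<open>1\<close> on, and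
  it reaches \<open>x = \<Theta>\<^sup>m\<^sup>+\<^sup>1 - 1\<close> at time \<open>\<Theta>\<^sup>m\<^sup>+\<^sup>1\<close>. Just after it has started towards \<open>x\<close>, at time
  \<open>s = \<Theta>\<^sup>m + 1\<close>, the transports \<open>-s \<rightarrow> 0\<close> and \<open>\<Theta>\<^sup>m - 1 \<rightarrow> x\<close> are released. The optimum, standing
  at \<open>-s\<close>, sweeps right and serves everything by time \<open>2 s + x\<close>, whereas Smartstart has to return
  from \<open>x\<close> to \<open>-s\<close> and come back, which takes \<open>2 (s + x)\<close> and makes it wait. The ratio tends to
  the claimed value as \<open>m \<rightarrow> \<infinity>\<close>.
\<close>

section \<open>Schedules\<close>

lemma serves_delivers:
  assumes "serves c B W as" "q \<in> B"
  shows "\<exists>xs zs. as = xs @ Deliver q # zs"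
  using assms
proof (induction c B W as rule: serves.induct)
  case (2 c B W q' as)
  then obtain xs zs where "as = xs @ Deliver q # zs" by auto
  then show ?case by (metis append_Cons)
next
  case (3 c B W q' as)
  show ?case
  proof (cases "q = q'")
    case True
    then show ?thesis by (metis append_Nil)
  next
    case False
    with 3 obtain xs zs where "as = xs @ Deliver q # zs" by auto
    then show ?thesis by (metis append_Cons)
  qed
qed auto

lemma serves_picks_up:
  assumes "serves c B W as" "q \<in> W"
  shows "\<exists>xs ys zs. as = xs @ Pickup q # ys @ Deliver q # zs"
  using assms
proof (induction c B W as rule: serves.induct)
  case (2 c B W q' as)
  show ?case
  proof (cases "q = q'")
    case True
    with 2 obtain ys zs where "as = ys @ Deliver q # zs"
      using serves_delivers[of c "insert q' B" "W - {q'}" as q] by auto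
    with True show ?thesis by (metis append_Nil)
  next
    case False
    with 2 obtain xs ys zs where "as = xs @ Pickup q # ys @ Deliver q # zs"
      by auto
    then show ?thesis by (metis append_Cons)
  qed
next
  case (3 c B W q' as)
  then obtain xs ys zs where "as = xs @ Pickup q # ys @ Deliver q # zs"
    by auto
  then show ?case by (metis append_Cons)
qed auto

lemma serves_last:
  assumes "serves c B W as" "as \<noteq> []"
  shows "\<exists>q\<in>B \<union> W. last as = Deliver q"
  using assms
proof (induction c B W as rule: serves.induct)
  case (2 c B W q as)
  then show ?case by (cases "as = []") auto
next
  case (3 c B W q as)
  then show ?case by (cases "as = []") auto
qed auto

text \<open>Pickup precedes delivery in the action list, and event times are sorted. Together with
  \<open>route_dist\<close>, this turns lower bounds on schedule lengths into distances between
  points that must be visited in a given order.\<close>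

lemma is_schedule_times:
  assumes S: "is_schedule c t p R S" and q: "q \<in> R"
  obtains t1 t2 where "t \<le> t1" "t1 \<le> t2" "t2 \<le> end_time t S"
    "route S t1 = source q" "route S t2 = target q" "release q \<le> t1"
proof -
  from S have "serves c {} R (map snd (events S))"
    by (simp add: is_schedule_def)
  from serves_picks_up[OF this q] obtain xs ys zs
    where "map snd (events S) = xs @ Pickup q # ys @ Deliver q # zs" by blast
  then obtain xs' t1 ys' t2 zs'
    where ev: "events S = xs' @ (t1, Pickup q) # ys' @ (t2, Deliver q) # zs'"
    by (auto simp: map_eq_append_conv map_eq_Cons_conv Cons_eq_map_conv append_eq_map_conv)
  from S have "sorted (t # map fst (events S))" by (simp add: is_schedule_def)
  then have ord: "t \<le> t1" "t1 \<le> t2" "\<forall>z\<in>set zs'. t2 \<le> fst z"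
    by (auto simp: ev sorted_append)
  have "t2 \<le> end_time t S"
    using ord(3) by (auto simp: end_time_def ev last_map)
  moreover from S have "route S t1 = source q" "route S t2 = target q" "release q \<le> t1"
    by (auto simp: is_schedule_def ev)
  ultimately show thesis using that ord by blast
qed

lemma route_dist:
  assumes "is_schedule c t p R S" "t \<le> t1" "t1 \<le> t2"
  shows "\<bar>route S t2 - route S t1\<bar> \<le> t2 - t1"
  using assms lipschitz_onD[of 1 "{t..}" "route S" t2 t1]
  by (auto simp: is_schedule_def dist_real_def)

text \<open>The last action can only be the delivery of \<open>q\<close>. So ties between shortest
  schedules do not affect where the server ends up, which \<open>run_lured\<close> relies
  on.\<close>

lemma is_schedule_end_pos:
  assumes S: "is_schedule c t p {q} S"
  shows "end_pos t S = target q"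
proof -
  have srv: "serves c {} {q} (map snd (events S))" and
    ok: "\<forall>e\<in>set (events S). event_ok (route S) e"
    using S by (auto simp: is_schedule_def)
  from srv have ne: "events S \<noteq> []" by auto
  obtain t' where l: "last (events S) = (t', Deliver q)"
    using serves_last[OF srv] ne by (cases "last (events S)") (auto simp: last_map)
  have "event_ok (route S) (t', Deliver q)"
    using ok ne l last_in_set by metis
  then show ?thesis
    using ne l by (simp add: end_pos_def end_time_def last_map)
qed

section \<open>The infimum \<open>L\<close> and sweeping schedules\<close>

lemma L_eq:
  assumes "is_schedule c t p R S"
    and "\<And>S'. is_schedule c t p R S' \<Longrightarrow> sched_length t S \<le> sched_length t S'"
  shows "L c t p R = sched_length t S"
  unfolding L_def by (rule cInf_eq_minimum) (use assms in auto)

lemma end_time_ge: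
  assumes "is_schedule c t p R S"
  shows "t \<le> end_time t S"
  using assms last_in_set[of "t # map fst (events S)"] by (auto simp: is_schedule_def end_time_def)

lemma L_le:
  assumes "is_schedule c t p R S"
  shows "L c t p R \<le> sched_length t S"
  unfolding L_def
proof (rule cInf_lower)
  \<comment> \<open>An infimum of reals bounds its set from below only if the set has a lower bound;
    0 is one, as no schedule ends before it starts.\<close>
  show "bdd_below {sched_length t S |S. is_schedule c t p R S}"
    by (rule bdd_belowI[of _ 0]) (auto simp: sched_length_def dest: end_time_ge)
qed (use assms in auto)

text \<open>Go left from \<open>p\<close> to \<open>b\<close>, then right forever: position \<open>y\<close> is passed rightwards at time
  \<open>t + p - 2 * b + y\<close>. The requests \<open>qs\<close> are served one after the other on the way right.\<close>

definition sweep :: "real \<Rightarrow> real \<Rightarrow> real \<Rightarrow> request list \<Rightarrow> schedule" where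
  "sweep t p b qs = \<lparr>route = (\<lambda>s. \<bar>s - (t + p - b)\<bar> + b),
     events = concat (map (\<lambda>q. [(t + p - 2 * b + source q, Pickup q),
       (t + p - 2 * b + target q, Deliver q)]) qs)\<rparr>"

text \<open>At most one request is on board at any time, so every capacity from 1 upwards is covered
  at once.\<close>

lemma serves_sequentially:
  assumes "distinct qs" "1 \<le> c"
  shows "serves c {} (set qs) (concat (map (\<lambda>q. [Pickup q, Deliver q]) qs))"
  using assms by (induction qs) (auto simp: one_enat_def)

lemma sweep_is_schedule:
  assumes "1 \<le> c" "b \<le> p" "distinct qs"
    and sorted: "sorted (b # concat (map (\<lambda>q. [source q, target q]) qs))"
    and rel: "\<And>q. q \<in> set qs \<Longrightarrow> release q \<le> t + p - 2 * b + source q"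
  shows "is_schedule c t p (set qs) (sweep t p b qs)"
proof -
  let ?T = "t + p - 2 * b"
  have "1-lipschitz_on {t..} (route (sweep t p b qs))"
    by (rule lipschitz_onI) (auto simp: sweep_def dist_real_def)
  moreover have "sorted (t # map fst (events (sweep t p b qs)))"
  proof -
    \<comment> \<open>Event times are positions shifted by \<open>?T\<close>, so sorted positions
      yield sorted times.\<close>
    have fst: "map fst (events (sweep t p b qs))
        = map ((+) ?T) (concat (map (\<lambda>q. [source q, target q]) qs))"
      by (simp add: sweep_def map_concat comp_def)
    have "sorted (map ((+) ?T) (concat (map (\<lambda>q. [source q, target q]) qs)))"
      using sorted by (auto intro!: sorted_map_mono intro: mono_onI)
    moreover have "t \<le> ?T + y" if "b \<le> y" for y
      using that assms(2) by simp
    ultimately show ?thesis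
      using sorted by (auto simp: fst)
  qed
  moreover have "map snd (events (sweep t p b qs)) = concat (map (\<lambda>q. [Pickup q, Deliver q]) qs)"
    by (simp add: sweep_def map_concat comp_def)
  moreover have "event_ok (route (sweep t p b qs)) e" if "e \<in> set (events (sweep t p b qs))" for e
    using that sorted rel by (fastforce simp: sweep_def)
  ultimately show ?thesis
    using assms serves_sequentially[of qs c]
    by (auto simp: is_schedule_def) (auto simp: sweep_def)
qed

lemma sweep_length:
  assumes "qs \<noteq> []"
  shows "sched_length t (sweep t p b qs) = p - 2 * b + target (last qs)"
  using assms by (cases qs rule: rev_cases) (auto simp: sched_length_def end_time_def sweep_def)

lemma shortest_single:
  assumes "1 \<le> c" "p \<le> source q" "source q = target q" "release q \<le> t"
  shows "shortest_schedule c t p {q} (sweep t p p [q])"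
    and "L c t p {q} = target q - p"
proof -
  have S: "is_schedule c t p {q} (sweep t p p [q])"
    using sweep_is_schedule[of c p p "[q]" t] assms by auto
  have len: "sched_length t (sweep t p p [q]) = target q - p"
    by (simp add: sweep_length)
  have min: "target q - p \<le> sched_length t S'" if S': "is_schedule c t p {q} S'" for S'
  proof -
    obtain t1 where "t \<le> t1" "t1 \<le> end_time t S'" "route S' t1 = target q"
      using is_schedule_times[OF S', of q] by (metis insertI1 order.trans)
    moreover from S' have "route S' t = p" by (simp add: is_schedule_def)
    ultimately show ?thesis
      using route_dist[OF S', of t t1] by (simp add: sched_length_def)
  qed
  show "shortest_schedule c t p {q} (sweep t p p [q])"
    using S min len by (simp add: shortest_schedule_def)
  show "L c t p {q} = target q - p"
    using L_eq[OF S] min len by simp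
qed

text \<open>The server stands at the target of \<open>B\<close>. Since \<open>u\<close> is at most
  \<open>x / 2\<close>, fetching \<open>B\<close> before going to \<open>- s\<close> costs at least
  as much as the sweep.\<close>

lemma shortest_return:
  assumes "1 \<le> c" "0 \<le> s" "0 \<le> u" "2 * u \<le> x" "r \<le> t"
  defines "A \<equiv> Request (- s) 0 r" and "B \<equiv> Request u x r"
  assumes "A \<noteq> B"
  shows "shortest_schedule c t x {A, B} (sweep t x (- s) [A, B])"
    and "L c t x {A, B} = 2 * (s + x)"
proof -
  have S: "is_schedule c t x {A, B} (sweep t x (- s) [A, B])"
  proof -
    have "release q \<le> t + x - 2 * - s + source q" if "q \<in> set [A, B]" for q
      using that assms by (auto simp: A_def B_def)
    then have "is_schedule c t x (set [A, B]) (sweep t x (- s) [A, B])"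
      by (intro sweep_is_schedule) (use assms in auto)
    then show ?thesis by simp
  qed
  have len: "sched_length t (sweep t x (- s) [A, B]) = 2 * (s + x)"
    by (simp add: sweep_length B_def)
  have min: "2 * (s + x) \<le> sched_length t S'" if S': "is_schedule c t x {A, B} S'" for S'
  proof -
    obtain a1 a2 where a: "t \<le> a1" "a1 \<le> a2" "a2 \<le> end_time t S'"
      "route S' a1 = - s" "route S' a2 = 0"
      by (rule is_schedule_times[OF S', of A]) (auto simp: A_def)
    obtain b1 b2 where b: "t \<le> b1" "b1 \<le> b2" "b2 \<le> end_time t S'"
      "route S' b1 = u" "route S' b2 = x"
      by (rule is_schedule_times[OF S', of B]) (auto simp: B_def)
    from S' have 0: "route S' t = x" by (simp add: is_schedule_def)
    note d = route_dist[OF S']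
    show ?thesis
    \<comment> \<open>In the first case the route visits \<open>x\<close>, \<open>- s\<close>,
      \<open>x\<close> in this order. Otherwise it visits \<open>x\<close>, \<open>u\<close>,
      \<open>x\<close>, \<open>- s\<close>, \<open>0\<close>, of total length
      \<open>3 * x - 2 * u + 2 * s\<close>, and \<open>2 * u \<le> x\<close> applies.\<close>
    proof (cases "a1 \<le> b2")
      case True
      then show ?thesis
        using d[of t a1] d[of a1 b2] a b 0 by (simp add: sched_length_def)
    next
      case False
      then show ?thesis
        using d[of t b1] d[of b1 b2] d[of b2 a1] d[of a1 a2] a b 0 assms
        by (simp add: sched_length_def)
    qed
  qed
  show "shortest_schedule c t x {A, B} (sweep t x (- s) [A, B])"
    using S min len by (simp add: shortest_schedule_def)
  show "L c t x {A, B} = 2 * (s + x)"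
    using L_eq[OF S] min len by simp
qed

section \<open>The instance\<close>

locale smartstart_lower_bound =
  fixes c :: enat and \<Theta> :: real and m :: nat
  assumes c: "1 \<le> c" and \<Theta>: "2 < \<Theta>" "\<Theta> < 3"
begin

text \<open>A server at \<open>\<Theta> ^ k - 1\<close> at time \<open>\<Theta> ^ k\<close> has
  distance \<open>(\<Theta> - 1) * \<Theta> ^ k\<close> to this point. It may start at once, and it
  arrives at time \<open>\<Theta> ^ Suc k\<close>, exactly when the next lure, if any,
  appears.\<close>

definition lure :: "nat \<Rightarrow> request" where
  "lure k = Request (\<Theta> ^ Suc k - 1) (\<Theta> ^ Suc k - 1) (\<Theta> ^ k)"

text \<open>The summand 1 keeps \<open>A\<close> and \<open>B\<close> out of the schedule that
  starts at time \<open>\<Theta> ^ m\<close>; it is negligible for large \<open>m\<close>.\<close>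

definition s :: real where "s = \<Theta> ^ m + 1"

definition x :: real where "x = \<Theta> ^ Suc m - 1"

definition A :: request where "A = Request (- s) 0 s"

text \<open>The source lies no further left than any lure before \<open>lure m\<close>, so that a
  rightward sweep can serve all of these before picking up \<open>B\<close>, even with capacity 1.
  It is also at most \<open>x / 2\<close>, as \<open>shortest_return\<close> requires.\<close>

definition B :: request where "B = Request (\<Theta> ^ m - 1) x s"

definition \<sigma> :: "request set" where "\<sigma> = lure ` {..m} \<union> {A, B}"

definition t_fin :: real where "t_fin = 2 * (s + x) / (\<Theta> - 1)"

section \<open>Arithmetic of the parameters\<close>

lemma power_le: "i \<le> j \<Longrightarrow> \<Theta> ^ i \<le> \<Theta> ^ j"
  using \<Theta> by (simp add: power_increasing)

lemma power_le_iff: "\<Theta> ^ i \<le> \<Theta> ^ j \<longleftrightarrow> i \<le> j"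
  using \<Theta> by simp

lemma power_ge_1: "1 \<le> \<Theta> ^ i"
  using power_le[of 0 i] by simp

lemma lure_simps [simp]:
  "source (lure k) = \<Theta> ^ Suc k - 1" "target (lure k) = \<Theta> ^ Suc k - 1" "release (lure k) = \<Theta> ^ k"
  by (simp_all add: lure_def)

lemma lure_eq_iff [simp]: "lure i = lure j \<longleftrightarrow> i = j"
  using power_le_iff[of i j] power_le_iff[of j i] by (auto simp: lure_def)

lemma s_pos: "2 \<le> s"
  using power_ge_1[of m] by (simp add: s_def)

lemma release_lure_less_s: "k \<le> m \<Longrightarrow> release (lure k) < s"
  using power_le[of k m] by (simp add: s_def)

lemma AB_neq: "A \<noteq> B"
  using s_pos power_ge_1[of m] by (auto simp: A_def B_def)

lemma AB_not_lure: "A \<notin> lure ` {..m}" "B \<notin> lure ` {..m}"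
  using release_lure_less_s by (fastforce simp: A_def B_def dest!: arg_cong[where f = release])+

text \<open>Used to see that \<open>A\<close> and \<open>B\<close> are already released when the
  server arrives at \<open>x\<close>.\<close>

lemma s_le: "s \<le> \<Theta> ^ Suc m"
proof -
  have "2 * \<Theta> ^ m \<le> \<Theta> * \<Theta> ^ m"
    using \<Theta> by (intro mult_right_mono) auto
  then show ?thesis using power_ge_1[of m] unfolding s_def power_Suc by linarith
qed

lemma s_x: "s + x = \<Theta> ^ m * (\<Theta> + 1)"
  by (simp add: s_def x_def algebra_simps)

text \<open>The source of the waiting claim: the server is free at \<open>x\<close> at time
  \<open>\<Theta> ^ Suc m\<close>. Divided by \<open>\<Theta> ^ m\<close>, the inequality reads
  \<open>\<Theta> * (\<Theta> - 1) < 2 * (\<Theta> + 1)\<close>, which follows from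
  \<open>\<Theta> < 3\<close>.\<close>

lemma t_fin_gt: "\<Theta> ^ Suc m < t_fin"
proof -
  have "\<Theta> * (\<Theta> - 1) < \<Theta> * 2" using \<Theta> by (intro mult_strict_left_mono) auto
  then have "\<Theta> * (\<Theta> - 1) < 2 * (\<Theta> + 1)" by simp
  then have "\<Theta> ^ m * (\<Theta> * (\<Theta> - 1)) < \<Theta> ^ m * (2 * (\<Theta> + 1))"
    using \<Theta> by (intro mult_strict_left_mono) auto
  then show ?thesis
    using \<Theta> unfolding t_fin_def s_x by (simp add: pos_less_divide_eq mult_ac)
qed

lemma \<sigma>_instance: "dar_instance \<sigma>"
  using s_pos \<Theta> by (auto simp: dar_instance_def \<sigma>_def A_def B_def)

section \<open>Schedules of Smartstart and of the optimum\<close>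

lemma L_lure:
  assumes "\<Theta> ^ k \<le> t"
  shows "L c t (\<Theta> ^ k - 1) {lure k} = \<Theta> ^ k * (\<Theta> - 1)"
    and "shortest_schedule c t (\<Theta> ^ k - 1) {lure k} (sweep t (\<Theta> ^ k - 1) (\<Theta> ^ k - 1) [lure k])"
  using shortest_single[of c "\<Theta> ^ k - 1" "lure k" t] c assms power_le[of k "Suc k"]
  by (auto simp: algebra_simps)

lemma L_final:
  assumes "s \<le> t"
  shows "L c t x {A, B} = 2 * (s + x)"
    and "shortest_schedule c t x {A, B} (sweep t x (- s) [A, B])"
proof -
  \<comment> \<open>Here \<open>2 < \<Theta>\<close> ensures that \<open>B\<close> starts at most
    halfway between 0 and \<open>x\<close>.\<close>
  have "\<Theta> ^ m * 2 \<le> \<Theta> ^ m * \<Theta>"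
    using \<Theta> by (intro mult_left_mono) auto
  then have "2 * (\<Theta> ^ m - 1) \<le> x" by (simp add: x_def mult.commute)
  then show "L c t x {A, B} = 2 * (s + x)"
    and "shortest_schedule c t x {A, B} (sweep t x (- s) [A, B])"
    using shortest_return[of c s "\<Theta> ^ m - 1" x s t] c s_pos power_ge_1[of m] assms AB_neq
    unfolding A_def B_def by auto
qed

text \<open>The server reaches \<open>- s\<close> at time \<open>s\<close>, just when
  \<open>A\<close> appears, and passes all other sources at time \<open>2 * s\<close> or later,
  after every release. \<open>lure m\<close> comes after \<open>B\<close> because it lies at the
  target of \<open>B\<close>.\<close>

lemma optimal_sweep: "is_schedule c 0 0 \<sigma> (sweep 0 0 (- s) (A # map lure [0..<m] @ [B, lure m]))"
  (is "is_schedule c 0 0 \<sigma> (sweep 0 0 (- s) ?qs)")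
proof -
  have set: "set ?qs = \<sigma>"
    by (auto simp: \<sigma>_def less_Suc_eq_le order_le_less)
  have dist: "distinct ?qs"
  proof -
    have "lure ` {..m} = insert (lure m) (set (map lure [0..<m]))"
      by (auto simp: order_le_less)
    then show ?thesis
      using AB_neq AB_not_lure by (simp add: distinct_map inj_on_def) auto
  qed
  have srt: "sorted (concat (map (\<lambda>q. [source q, target q]) (map lure [0..<k])))" for k
    by (induction k) (auto simp: sorted_append power_le simp del: power_Suc)
  have *: "1 \<le> \<Theta> ^ k" "\<Theta> ^ Suc i \<le> \<Theta> ^ m" "\<Theta> ^ Suc i \<le> \<Theta> ^ Suc m" "\<Theta> ^ m \<le> \<Theta> ^ Suc m"
    if "i < m" for i k
    using that by (auto simp: power_ge_1 power_le simp del: power_Suc)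
  have "sorted (- s # concat (map (\<lambda>q. [source q, target q]) ?qs))"
    using s_pos srt[of m] * power_ge_1[of m] power_ge_1[of "Suc m"] power_le[of m "Suc m"]
    by (auto simp: sorted_append A_def B_def x_def simp del: power_Suc)
       (smt (verit) *)+
  moreover have "release q \<le> 0 + 0 - 2 * (- s) + source q" if q: "q \<in> set ?qs" for q
  proof -
    consider "q = A" | "q = B" | k where "q = lure k" "k \<le> m"
      using q unfolding set \<sigma>_def by blast
    then show ?thesis
    proof cases
      case 3
      then show ?thesis
        using s_pos release_lure_less_s[of k] power_ge_1[of "Suc k"] by (simp del: power_Suc)
    qed (use s_pos power_ge_1[of m] in \<open>auto simp: A_def B_def\<close>)
  qed
  ultimately show ?thesis
    using sweep_is_schedule[OF c _ dist, of "- s" 0 0] s_pos set by simp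
qed

lemma Opt_le: "Opt c \<sigma> \<le> 2 * s + x"
  using L_le[OF optimal_sweep] by (simp add: Opt_def sweep_length x_def)

text \<open>The optimum is a denominator later. It is positive because \<open>A\<close> cannot be
  picked up before its release at time \<open>s\<close>.\<close>

lemma Opt_pos: "0 < Opt c \<sigma>"
proof -
  have "s \<le> Opt c \<sigma>"
    unfolding Opt_def L_def
  proof (rule cInf_greatest)
    fix l assume "l \<in> {sched_length 0 S |S. is_schedule c 0 0 \<sigma> S}"
    then obtain S where S: "is_schedule c 0 0 \<sigma> S" and l: "l = sched_length 0 S" by blast
    have "A \<in> \<sigma>" by (simp add: \<sigma>_def)
    then show "s \<le> l"
      by (rule is_schedule_times[OF S]) (simp add: l sched_length_def A_def)
  qed (use optimal_sweep in blast)
  then show ?thesis using s_pos by simp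
qed

section \<open>The runs\<close>

text \<open>The invariant of the luring phase. Schedules count from 1 and lures from 0, hence the
  shift; the schedules themselves stay open because ties may be broken arbitrarily.\<close>

definition lured :: "run \<Rightarrow> nat \<Rightarrow> bool" where
  "lured \<rho> k \<longleftrightarrow> (\<forall>i<k. start_time \<rho> (Suc i) = \<Theta> ^ i \<and>
     start_pos \<rho> (Suc i) = \<Theta> ^ i - 1 \<and> served \<rho> (Suc i) = {lure i})"

lemma lured_served:
  assumes "lured \<rho> k"
  shows "(\<Union>i\<in>{1..<Suc k}. served \<rho> i) = lure ` {..<k}"
proof -
  have "{1..<Suc k} = Suc ` {..<k}" by (simp add: lessThan_atLeast0)
  then show ?thesis using assms by (auto simp: lured_def)
qed

text \<open>The case \<open>k = 0\<close> is separate: the server is free at time 0, but the first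
  lure appears at time \<open>\<Theta> ^ 0 = 1\<close>.\<close>

lemma lured_finish:
  assumes "lured \<rho> k"
  shows "finish c \<rho> k = (if k = 0 then 0 else \<Theta> ^ k)"
proof (cases k)
  case (Suc i)
  have "\<Theta> ^ i + \<Theta> ^ i * (\<Theta> - 1) = \<Theta> ^ Suc i" by (simp add: algebra_simps)
  then show ?thesis
    using Suc assms L_lure(1)[of i "\<Theta> ^ i"] by (simp add: finish_def lured_def)
qed (simp add: finish_def)

text \<open>The bound \<open>\<Theta> ^ Suc k\<close> on \<open>t\<close> excludes the later lures,
  and the bound \<open>s\<close> excludes \<open>A\<close> and \<open>B\<close>.\<close>

lemma lured_pending:
  assumes "lured \<rho> k" "k \<le> m" "t < \<Theta> ^ Suc k" "t < s"
  shows "pending \<sigma> \<rho> (Suc k) t = (if \<Theta> ^ k \<le> t then {lure k} else {})"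
proof -
  have "q \<in> pending \<sigma> \<rho> (Suc k) t \<longleftrightarrow> (\<exists>i. q = lure i \<and> k \<le> i \<and> i \<le> m \<and> \<Theta> ^ i \<le> t)" for q
    unfolding pending_def lured_served[OF assms(1)]
    using assms(4) by (auto simp: \<sigma>_def A_def B_def)
  moreover have "i \<le> k" if "\<Theta> ^ i \<le> t" for i
    using that assms(3) power_le_iff[of "Suc k" i] by linarith
  ultimately have "q \<in> pending \<sigma> \<rho> (Suc k) t \<longleftrightarrow> q = lure k \<and> \<Theta> ^ k \<le> t" for q
    using assms(2) by (metis order_antisym order_refl)
  then show ?thesis by auto
qed

lemma lured_step:
  assumes "lured \<rho> k" "k \<le> m" "start_pos \<rho> (Suc k) = \<Theta> ^ k - 1"
  shows "may_start c \<Theta> \<sigma> \<rho> (Suc k) (\<Theta> ^ k)"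
    and "may_start c \<Theta> \<sigma> \<rho> (Suc k) t \<Longrightarrow> \<Theta> ^ k \<le> t"
    and "pending \<sigma> \<rho> (Suc k) (\<Theta> ^ k) = {lure k}"
proof -
  have lt: "\<Theta> ^ k < \<Theta> ^ Suc k" "\<Theta> ^ k < s"
    using \<Theta> release_lure_less_s[OF assms(2)] by (auto simp: power_strict_increasing)
  show pend: "pending \<sigma> \<rho> (Suc k) (\<Theta> ^ k) = {lure k}"
    using lured_pending[OF assms(1,2) lt] by simp
  \<comment> \<open>The waiting condition holds with equality.\<close>
  show "may_start c \<Theta> \<sigma> \<rho> (Suc k) (\<Theta> ^ k)"
    using \<Theta> L_lure(1)[of k "\<Theta> ^ k"] pend assms(3) lured_finish[OF assms(1)]
    by (simp add: may_start_def)
  show "\<Theta> ^ k \<le> t" if "may_start c \<Theta> \<sigma> \<rho> (Suc k) t"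
  proof (rule ccontr)
    assume *: "\<not> \<Theta> ^ k \<le> t"
    with lt have "t < \<Theta> ^ Suc k" "t < s" by linarith+
    from lured_pending[OF assms(1,2) this] have "pending \<sigma> \<rho> (Suc k) t = {}"
      unfolding if_not_P[OF *] .
    then show False
      using that by (simp add: may_start_def)
  qed
qed

text \<open>From the arrival at \<open>x\<close> on, neither the pending set nor its
  \<open>L\<close> changes, so the waiting condition reduces to the threshold
  \<open>t_fin\<close>.\<close>

lemma final_step:
  assumes "lured \<rho> (Suc m)" "start_pos \<rho> (Suc (Suc m)) = x"
  shows "may_start c \<Theta> \<sigma> \<rho> (Suc (Suc m)) t_fin"
    and "may_start c \<Theta> \<sigma> \<rho> (Suc (Suc m)) t \<Longrightarrow> t_fin \<le> t"
    and "pending \<sigma> \<rho> (Suc (Suc m)) t_fin = {A, B}"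
proof -
  have pend: "pending \<sigma> \<rho> (Suc (Suc m)) t = {A, B}" if "\<Theta> ^ Suc m \<le> t" for t
  proof -
    have "release A \<le> t" "release B \<le> t"
      using that s_le by (simp_all add: A_def B_def)
    then show ?thesis
      unfolding pending_def lured_served[OF assms(1)] lessThan_Suc_atMost \<sigma>_def
      using AB_not_lure by (auto simp del: lure_simps)
  qed
  show "pending \<sigma> \<rho> (Suc (Suc m)) t_fin = {A, B}"
    using pend[of t_fin] t_fin_gt by simp
  have iff: "may_start c \<Theta> \<sigma> \<rho> (Suc (Suc m)) t \<longleftrightarrow> \<Theta> ^ Suc m \<le> t \<and> t_fin \<le> t" for t
    using pend[of t] L_final(1)[of t] s_le assms(2) lured_finish[OF assms(1)]
    unfolding may_start_def t_fin_def by (cases "\<Theta> ^ Suc m \<le> t") (simp_all del: power_Suc)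
  show "may_start c \<Theta> \<sigma> \<rho> (Suc (Suc m)) t_fin"
    using iff t_fin_gt by simp
  show "t_fin \<le> t" if "may_start c \<Theta> \<sigma> \<rho> (Suc (Suc m)) t"
    using that iff by simp
qed

section \<open>Existence of a run, and the course of every run\<close>

lemma run_exists: "\<exists>\<rho>. smartstart_run c \<Theta> \<sigma> \<rho>"
proof -
  \<comment> \<open>Having a run keeps the claim about all runs from being vacuous. The final sweep
    ends at the target \<open>x\<close> of \<open>B\<close>, hence the special value of
    \<open>start_pos\<close> at the index after the last schedule.\<close>
  define \<rho> where "\<rho> = \<lparr>num_scheds = Suc (Suc m),
    start_time = (\<lambda>j. if j = Suc (Suc m) then t_fin else \<Theta> ^ (j - 1)),
    start_pos = (\<lambda>j. if j = Suc (Suc (Suc m)) then x else \<Theta> ^ (j - 1) - 1),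
    served = (\<lambda>j. if j = Suc (Suc m) then {A, B} else {lure (j - 1)}),
    sched = (\<lambda>j. if j = Suc (Suc m) then sweep t_fin x (- s) [A, B]
      else sweep (\<Theta> ^ (j - 1)) (\<Theta> ^ (j - 1) - 1) (\<Theta> ^ (j - 1) - 1) [lure (j - 1)])\<rparr>"
  have lured: "lured \<rho> k" if "k \<le> Suc m" for k
    using that by (auto simp: lured_def \<rho>_def)
  have pos: "start_pos \<rho> (Suc (Suc m)) = x"
    by (simp add: \<rho>_def x_def)
  have "may_start c \<Theta> \<sigma> \<rho> j (start_time \<rho> j) \<and>
        (\<forall>t. may_start c \<Theta> \<sigma> \<rho> j t \<longrightarrow> start_time \<rho> j \<le> t) \<and>
        served \<rho> j = pending \<sigma> \<rho> j (start_time \<rho> j) \<and>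
        shortest_schedule c (start_time \<rho> j) (start_pos \<rho> j) (served \<rho> j) (sched \<rho> j) \<and>
        start_pos \<rho> (Suc j) = end_pos (start_time \<rho> j) (sched \<rho> j)"
    if "j \<in> {1..num_scheds \<rho>}" for j
  proof (cases "j = Suc (Suc m)")
    case True
    have "end_pos t_fin (sweep t_fin x (- s) [A, B]) = x"
      using s_pos power_ge_1[of "Suc m"]
      by (simp add: end_pos_def end_time_def sweep_def B_def x_def)
    then show ?thesis
      using True final_step[OF lured pos] L_final(2)[of t_fin] s_le t_fin_gt pos
      by (simp add: \<rho>_def)
  next
    case False
    with that obtain k where k: "j = Suc k" "k \<le> m"
      by (cases j) (auto simp: \<rho>_def)
    have \<rho>: "start_time \<rho> (Suc k) = \<Theta> ^ k" "start_pos \<rho> (Suc k) = \<Theta> ^ k - 1"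
      "served \<rho> (Suc k) = {lure k}" "start_pos \<rho> (Suc (Suc k)) = \<Theta> ^ Suc k - 1"
      "sched \<rho> (Suc k) = sweep (\<Theta> ^ k) (\<Theta> ^ k - 1) (\<Theta> ^ k - 1) [lure k]"
      using k by (auto simp: \<rho>_def)
    have sh: "shortest_schedule c (\<Theta> ^ k) (\<Theta> ^ k - 1) {lure k}
        (sweep (\<Theta> ^ k) (\<Theta> ^ k - 1) (\<Theta> ^ k - 1) [lure k])"
      by (rule L_lure(2)) simp
    then have "end_pos (\<Theta> ^ k) (sweep (\<Theta> ^ k) (\<Theta> ^ k - 1) (\<Theta> ^ k - 1) [lure k]) = \<Theta> ^ Suc k - 1"
      using is_schedule_end_pos by (fastforce simp: shortest_schedule_def)
    with sh show ?thesis
      unfolding k(1) \<rho> using lured_step[OF lured k(2) \<rho>(2)] k by simp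
  qed
  moreover have "(\<Union>j\<in>{1..num_scheds \<rho>}. served \<rho> j) = \<sigma>"
  proof -
    have "{1..num_scheds \<rho>} = insert (Suc (Suc m)) {1..<Suc (Suc m)}"
      by (auto simp: \<rho>_def)
    then show ?thesis
      using lured_served[OF lured[of "Suc m"]]
      by (auto simp: \<sigma>_def lessThan_Suc_atMost) (auto simp: \<rho>_def)
  qed
  moreover have "start_pos \<rho> 1 = 0" by (simp add: \<rho>_def)
  ultimately have "smartstart_run c \<Theta> \<sigma> \<rho>"
    unfolding smartstart_run_def by blast
  then show ?thesis ..
qed

text \<open>Starting times are forced as least admissible times, and served sets as pending sets.
  Ties can only change the routes, not their end. The induction stops at
  \<open>num_scheds \<rho>\<close>, since a run constrains nothing beyond it.\<close>

lemma run_lured: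
  assumes run: "smartstart_run c \<Theta> \<sigma> \<rho>"
  shows "k \<le> num_scheds \<rho> \<Longrightarrow> k \<le> Suc m \<Longrightarrow> lured \<rho> k \<and> start_pos \<rho> (Suc k) = \<Theta> ^ k - 1"
proof (induction k)
  case 0
  then show ?case using run by (simp add: lured_def smartstart_run_def)
next
  case (Suc k)
  then have l: "lured \<rho> k" and p: "start_pos \<rho> (Suc k) = \<Theta> ^ k - 1" and k: "k \<le> m" by auto
  note step = lured_step[OF l k p]
  have "Suc k \<in> {1..num_scheds \<rho>}" using Suc.prems by simp
  with run have r: "may_start c \<Theta> \<sigma> \<rho> (Suc k) (start_time \<rho> (Suc k))"
    "\<And>t. may_start c \<Theta> \<sigma> \<rho> (Suc k) t \<Longrightarrow> start_time \<rho> (Suc k) \<le> t"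
    "served \<rho> (Suc k) = pending \<sigma> \<rho> (Suc k) (start_time \<rho> (Suc k))"
    "shortest_schedule c (start_time \<rho> (Suc k)) (start_pos \<rho> (Suc k)) (served \<rho> (Suc k)) (sched \<rho> (Suc k))"
    "start_pos \<rho> (Suc (Suc k)) = end_pos (start_time \<rho> (Suc k)) (sched \<rho> (Suc k))"
    unfolding smartstart_run_def by blast+
  have t: "start_time \<rho> (Suc k) = \<Theta> ^ k"
    using r(2)[OF step(1)] step(2)[OF r(1)] by simp
  then have srv: "served \<rho> (Suc k) = {lure k}" using r(3) step(3) by simp
  have "start_pos \<rho> (Suc (Suc k)) = \<Theta> ^ Suc k - 1"
    using r(4,5) srv is_schedule_end_pos by (fastforce simp: shortest_schedule_def)
  moreover have "lured \<rho> (Suc k)"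
    using l t p srv by (auto simp: lured_def less_Suc_eq)
  ultimately show ?case by simp
qed

lemma run_final:
  assumes run: "smartstart_run c \<Theta> \<sigma> \<rho>"
  shows "num_scheds \<rho> = Suc (Suc m)" "start_time \<rho> (Suc (Suc m)) = t_fin"
    "finish c \<rho> (Suc m) = \<Theta> ^ Suc m" "finish c \<rho> (Suc (Suc m)) = t_fin + 2 * (s + x)"
proof -
  have un: "(\<Union>j\<in>{1..num_scheds \<rho>}. served \<rho> j) = \<sigma>"
    using run unfolding smartstart_run_def by blast
  \<comment> \<open>With fewer schedules only lures would be served, and \<open>A\<close> would be
    missing.\<close>
  have N: "Suc (Suc m) \<le> num_scheds \<rho>"
  proof (rule ccontr)
    assume "\<not> ?thesis"
    then have le: "num_scheds \<rho> \<le> Suc m" by simp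
    then have "(\<Union>j\<in>{1..num_scheds \<rho>}. served \<rho> j) = lure ` {..<num_scheds \<rho>}"
      using lured_served[of \<rho> "num_scheds \<rho>"] run_lured[OF run, of "num_scheds \<rho>"]
      by (simp add: atLeastLessThanSuc_atLeastAtMost)
    with un have "\<sigma> = lure ` {..<num_scheds \<rho>}" by simp
    moreover have "A \<in> \<sigma>" by (simp add: \<sigma>_def)
    ultimately have "A \<in> lure ` {..<num_scheds \<rho>}" by (rule subst)
    moreover have "{..<num_scheds \<rho>} \<subseteq> {..m}" using le by auto
    ultimately show False using AB_not_lure(1) image_mono[of _ "{..m}" lure] by (meson subsetD)
  qed
  then have l: "lured \<rho> (Suc m)" and p: "start_pos \<rho> (Suc (Suc m)) = x"
    using run_lured[OF run, of "Suc m"] unfolding x_def by simp_all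
  note step = final_step[OF l p]
  have "Suc (Suc m) \<in> {1..num_scheds \<rho>}" using N by simp
  with run have r: "may_start c \<Theta> \<sigma> \<rho> (Suc (Suc m)) (start_time \<rho> (Suc (Suc m)))"
    "\<And>t. may_start c \<Theta> \<sigma> \<rho> (Suc (Suc m)) t \<Longrightarrow> start_time \<rho> (Suc (Suc m)) \<le> t"
    "served \<rho> (Suc (Suc m)) = pending \<sigma> \<rho> (Suc (Suc m)) (start_time \<rho> (Suc (Suc m)))"
    unfolding smartstart_run_def by blast+
  show t: "start_time \<rho> (Suc (Suc m)) = t_fin"
    using r(2)[OF step(1)] step(2)[OF r(1)] by simp
  then have srv: "served \<rho> (Suc (Suc m)) = {A, B}" using r(3) step(3) by simp
  show "finish c \<rho> (Suc m) = \<Theta> ^ Suc m"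
    using lured_finish[OF l] by simp
  show "finish c \<rho> (Suc (Suc m)) = t_fin + 2 * (s + x)"
    using L_final(1)[of t_fin] s_le t_fin_gt t p srv unfolding finish_def by simp
  \<comment> \<open>A further schedule could not start, because nothing would be pending.\<close>
  show "num_scheds \<rho> = Suc (Suc m)"
  proof (rule ccontr)
    assume "\<not> ?thesis"
    with N have "Suc (Suc (Suc m)) \<in> {1..num_scheds \<rho>}" by simp
    with run have "may_start c \<Theta> \<sigma> \<rho> (Suc (Suc (Suc m))) (start_time \<rho> (Suc (Suc (Suc m))))"
      unfolding smartstart_run_def by blast
    then have "pending \<sigma> \<rho> (Suc (Suc (Suc m))) (start_time \<rho> (Suc (Suc (Suc m)))) \<noteq> {}"
      by (simp add: may_start_def)
    moreover have "(\<Union>i\<in>{1..<Suc (Suc (Suc m))}. served \<rho> i) = \<sigma>"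
    proof -
      have "{1..<Suc (Suc (Suc m))} = insert (Suc (Suc m)) {1..<Suc (Suc m)}" by auto
      then show ?thesis
        using lured_served[OF l] srv
        by (simp only: UN_insert \<sigma>_def lessThan_Suc_atMost Un_commute)
    qed
    ultimately show False unfolding pending_def by blast
  qed
qed

section \<open>Waiting and the ratio\<close>

lemma run_waits:
  assumes "smartstart_run c \<Theta> \<sigma> \<rho>"
  shows "waits_before_final c \<rho>"
  using run_final[OF assms] t_fin_gt by (simp add: waits_before_final_def)

text \<open>The cost is exactly the claimed ratio times \<open>K\<close>, because the constants
  cancel in \<open>s + x\<close>. They leave \<open>2 * s + x = K + 1\<close> as bound on the
  optimum, whence the factor \<open>K / (K + 1)\<close>.\<close>

lemma run_ratio:
  assumes "smartstart_run c \<Theta> \<sigma> \<rho>"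
  defines "K \<equiv> (\<Theta> + 2) * \<Theta> ^ m"
  shows "(2 * \<Theta>\<^sup>2 + 2 * \<Theta>) / (\<Theta>\<^sup>2 + \<Theta> - 2) * (K / (K + 1)) \<le> smartstart_cost c \<rho> / Opt c \<sigma>"
proof -
  have K: "2 * s + x = K + 1"
    by (simp add: s_def x_def K_def algebra_simps)
  have "0 < K" using \<Theta> by (simp add: K_def)
  have fac: "\<Theta>\<^sup>2 + \<Theta> - 2 = (\<Theta> - 1) * (\<Theta> + 2)"
    by (simp add: power2_eq_square algebra_simps)
  have "smartstart_cost c \<rho> = t_fin + 2 * (s + x)"
    using run_final[OF assms(1)] by (simp add: smartstart_cost_def)
  also have "\<dots> = 2 * \<Theta> * (\<Theta> + 1) * \<Theta> ^ m / (\<Theta> - 1)"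
    using \<Theta> unfolding t_fin_def s_x by (simp add: field_simps)
  also have "\<dots> = (2 * \<Theta>\<^sup>2 + 2 * \<Theta>) / (\<Theta>\<^sup>2 + \<Theta> - 2) * K"
  proof -
    have "2 * \<Theta>\<^sup>2 + 2 * \<Theta> = 2 * \<Theta> * (\<Theta> + 1)"
      by (simp add: power2_eq_square algebra_simps)
    then show ?thesis
      using \<Theta> unfolding fac K_def by simp
  qed
  finally have cost: "smartstart_cost c \<rho> = (2 * \<Theta>\<^sup>2 + 2 * \<Theta>) / (\<Theta>\<^sup>2 + \<Theta> - 2) * K" .
  have "0 \<le> (2 * \<Theta>\<^sup>2 + 2 * \<Theta>) / (\<Theta>\<^sup>2 + \<Theta> - 2) * K"
    using \<Theta> \<open>0 < K\<close> unfolding fac by simp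
  then have "(2 * \<Theta>\<^sup>2 + 2 * \<Theta>) / (\<Theta>\<^sup>2 + \<Theta> - 2) * K / (K + 1) \<le> smartstart_cost c \<rho> / Opt c \<sigma>"
    unfolding cost by (intro divide_left_mono) (use Opt_le Opt_pos K \<open>0 < K\<close> in auto)
  then show ?thesis by simp
qed

end

theorem proposition4p2:
  fixes c :: enat and \<Theta> :: real
  assumes "1 \<le> c" and "2 < \<Theta>" and "\<Theta> < 3"
  shows "\<exists>\<epsilon>\<^sub>0>0. \<forall>\<epsilon>. 0 < \<epsilon> \<and> \<epsilon> < \<epsilon>\<^sub>0 \<longrightarrow>
    (\<exists>\<sigma>. dar_instance \<sigma> \<and>
      (\<exists>\<rho>. smartstart_run c \<Theta> \<sigma> \<rho>) \<and>
      (\<forall>\<rho>. smartstart_run c \<Theta> \<sigma> \<rho> \<longrightarrow>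
        waits_before_final c \<rho> \<and>
        smartstart_cost c \<rho> / Opt c \<sigma>
          \<ge> (2 * \<Theta>\<^sup>2 + 2 * \<Theta>) / (\<Theta>\<^sup>2 + \<Theta> - 2) - \<epsilon>))"
\<comment> \<open>The construction handles every positive \<open>\<epsilon>\<close>, so the
  threshold 1 is an arbitrary choice.\<close>
proof (intro exI[of _ 1] conjI allI impI)
  fix \<epsilon> :: real
  assume \<epsilon>: "0 < \<epsilon> \<and> \<epsilon> < 1"
  define C where "C = (2 * \<Theta>\<^sup>2 + 2 * \<Theta>) / (\<Theta>\<^sup>2 + \<Theta> - 2)"
  \<comment> \<open>The loss against \<open>C\<close> will be \<open>C / (K + 1)\<close>; as
    \<open>K\<close> is at least \<open>\<Theta> ^ m\<close>, this choice makes it at most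
    \<open>\<epsilon>\<close>.\<close>
  obtain m where m: "C / \<epsilon> < \<Theta> ^ m"
    using real_arch_pow[of \<Theta> "C / \<epsilon>"] assms by auto
  interpret smartstart_lower_bound c \<Theta> m
    by unfold_locales (use assms in auto)
  define K where "K = (\<Theta> + 2) * \<Theta> ^ m"
  have "1 * \<Theta> ^ m \<le> K"
    unfolding K_def using assms by (intro mult_right_mono) auto
  moreover have "0 < \<Theta> ^ m" using assms by simp
  ultimately have K: "0 < K" "C / \<epsilon> < K + 1" using m by linarith+
  then have "C / (K + 1) \<le> \<epsilon>"
    using \<epsilon> by (simp add: field_simps)
  moreover have "C * (K / (K + 1)) = C - C / (K + 1)"
    using K by (simp add: field_simps)
  ultimately have "C - \<epsilon> \<le> C * (K / (K + 1))" by simp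
  then have "C - \<epsilon> \<le> smartstart_cost c \<rho> / Opt c \<sigma>" if "smartstart_run c \<Theta> \<sigma> \<rho>" for \<rho>
    using run_ratio[OF that] unfolding C_def K_def by linarith
  then show "\<exists>\<sigma>. dar_instance \<sigma> \<and>
      (\<exists>\<rho>. smartstart_run c \<Theta> \<sigma> \<rho>) \<and>
      (\<forall>\<rho>. smartstart_run c \<Theta> \<sigma> \<rho> \<longrightarrow>
        waits_before_final c \<rho> \<and>
        smartstart_cost c \<rho> / Opt c \<sigma>
          \<ge> (2 * \<Theta>\<^sup>2 + 2 * \<Theta>) / (\<Theta>\<^sup>2 + \<Theta> - 2) - \<epsilon>)"
    using \<sigma>_instance run_exists run_waits unfolding C_def by blast
qed simp

end
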